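(* Let $G$ be an infinite countable group with unity $e$ and let $K\subset G$ be a finite set containing $e$ and at least one more element. Then the $K$-shift $\Omega_K\subset\{0,1\}^G$, consisting of the indicator functions of all maximal $K$-separated subsets of $G$, has the specification property with margin $M=KK^{-1}K$.
   Context: A set $V\subset G$ is $K$-separated if the sets $Kg$, $g\in V$, are pairwise disjoint; it is maximal $K$-separated if moreover $V\cup\{g\}$ is not $K$-separated for any $g\in G\setminus V$. $G$ acts on $\{0,1\}^G$ by $(h(x))(g)=x(gh)$, and $\Omega_K$ is a closed invariant set (a subshift). For a subshift $X\subset\Lambda^G$ ($\Lambda$ finite), a pattern over $A\subset G$ is a function $\alpha:A\to\Lambda$; it is $X$-admissible if there are $x\in X$ and $g\in G$ with $x(ag)=\alpha(a)$ for all $a\in A$. For a finite $M\subset G$ with $e\in M$, sets $A_1,A_2\subset G$ are $M$-apart if $MA_1\cap MA_2=\varnothing$. A nontrivial subshift $X$ (at least two admissible symbols) has the specification property with margin $M$ if whenever $A_1,A_2\subset G$ (possibly infinite) are $M$-apart and $\alpha_1,\alpha_2$ are $X$-admissible patterns over $A_1,A_2$, the pattern over $A_1\cup A_2$ that restricts to $\alpha_1$ on $A_1$ and to $\alpha_2$ on $A_2$ is $X$-admissible. *)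

theory Defs
  imports "HOL-Analysis.Analysis" "HOL-Algebra.Coset"
begin

text \<open>
  Throughout, the group is a locale-style group \<open>G\<close>, the alphabet is a set \<open>\<Lambda>\<close>, and a configuration
  is an element of the extensional function space \<open>carrier G \<rightarrow>\<^sub>E \<Lambda>\<close>.
\<close>

definition shift_action :: "('a, 'm) monoid_scheme \<Rightarrow> 'a \<Rightarrow> ('a \<Rightarrow> 'b) \<Rightarrow> 'a \<Rightarrow> 'b" where
  "shift_action G h x = (\<lambda>g\<in>carrier G. x (g \<otimes>\<^bsub>G\<^esub> h))"

definition subshift :: "('a, 'm) monoid_scheme \<Rightarrow> 'b set \<Rightarrow> ('a \<Rightarrow> 'b) set \<Rightarrow> bool" where
  "subshift G \<Lambda> X \<longleftrightarrow>
     finite \<Lambda> \<and>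
     closedin (product_topology (\<lambda>_. discrete_topology \<Lambda>) (carrier G)) X \<and>
     (\<forall>h\<in>carrier G. shift_action G h ` X = X)"

definition admissible ::
  "('a, 'm) monoid_scheme \<Rightarrow> ('a \<Rightarrow> 'b) set \<Rightarrow> 'a set \<Rightarrow> ('a \<Rightarrow> 'b) \<Rightarrow> bool" where
  "admissible G X A \<alpha> \<longleftrightarrow> (\<exists>x\<in>X. \<exists>g\<in>carrier G. \<forall>a\<in>A. x (a \<otimes>\<^bsub>G\<^esub> g) = \<alpha> a)"

text \<open>A symbol is identified with the pattern over \<open>{\<one>\<^bsub>G\<^esub>}\<close> carrying it.\<close>

definition admissible_symbols ::
  "('a, 'm) monoid_scheme \<Rightarrow> 'b set \<Rightarrow> ('a \<Rightarrow> 'b) set \<Rightarrow> 'b set" where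
  "admissible_symbols G \<Lambda> X = {s \<in> \<Lambda>. admissible G X {\<one>\<^bsub>G\<^esub>} (\<lambda>_\<in>{\<one>\<^bsub>G\<^esub>}. s)}"

definition nontrivial_subshift ::
  "('a, 'm) monoid_scheme \<Rightarrow> 'b set \<Rightarrow> ('a \<Rightarrow> 'b) set \<Rightarrow> bool" where
  "nontrivial_subshift G \<Lambda> X \<longleftrightarrow>
     subshift G \<Lambda> X \<and>
     (\<exists>s\<in>admissible_symbols G \<Lambda> X. \<exists>t\<in>admissible_symbols G \<Lambda> X. s \<noteq> t)"

definition apart :: "('a, 'm) monoid_scheme \<Rightarrow> 'a set \<Rightarrow> 'a set \<Rightarrow> 'a set \<Rightarrow> bool" where
  "apart G M A\<^sub>1 A\<^sub>2 \<longleftrightarrow> (M <#>\<^bsub>G\<^esub> A\<^sub>1) \<inter> (M <#>\<^bsub>G\<^esub> A\<^sub>2) = {}"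

text \<open>
  Since \<open>\<one>\<^bsub>G\<^esub> \<in> M\<close>, \<open>M\<close>-apart sets are disjoint, so the joint pattern below restricts to \<open>\<alpha>\<^sub>1\<close> on
  \<open>A\<^sub>1\<close> and to \<open>\<alpha>\<^sub>2\<close> on \<open>A\<^sub>2\<close>.
\<close>

definition specification_property ::
  "('a, 'm) monoid_scheme \<Rightarrow> 'b set \<Rightarrow> ('a \<Rightarrow> 'b) set \<Rightarrow> 'a set \<Rightarrow> bool" where
  "specification_property G \<Lambda> X M \<longleftrightarrow>
     nontrivial_subshift G \<Lambda> X \<and>
     finite M \<and> M \<subseteq> carrier G \<and> \<one>\<^bsub>G\<^esub> \<in> M \<and>
     (\<forall>A\<^sub>1 A\<^sub>2. A\<^sub>1 \<subseteq> carrier G \<and> A\<^sub>2 \<subseteq> carrier G \<and> apart G M A\<^sub>1 A\<^sub>2 \<longrightarrow>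
       (\<forall>\<alpha>\<^sub>1 \<in> A\<^sub>1 \<rightarrow>\<^sub>E \<Lambda>. \<forall>\<alpha>\<^sub>2 \<in> A\<^sub>2 \<rightarrow>\<^sub>E \<Lambda>.
          admissible G X A\<^sub>1 \<alpha>\<^sub>1 \<and> admissible G X A\<^sub>2 \<alpha>\<^sub>2 \<longrightarrow>
          admissible G X (A\<^sub>1 \<union> A\<^sub>2) (\<lambda>a\<in>A\<^sub>1 \<union> A\<^sub>2. if a \<in> A\<^sub>1 then \<alpha>\<^sub>1 a else \<alpha>\<^sub>2 a)))"

definition separated :: "('a, 'm) monoid_scheme \<Rightarrow> 'a set \<Rightarrow> 'a set \<Rightarrow> bool" where
  "separated G K V \<longleftrightarrow> V \<subseteq> carrier G \<and> disjoint_family_on (\<lambda>g. K #>\<^bsub>G\<^esub> g) V"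

definition maximal_separated :: "('a, 'm) monoid_scheme \<Rightarrow> 'a set \<Rightarrow> 'a set \<Rightarrow> bool" where
  "maximal_separated G K V \<longleftrightarrow>
     separated G K V \<and> (\<forall>g \<in> carrier G - V. \<not> separated G K (V \<union> {g}))"

definition K_shift :: "('a, 'm) monoid_scheme \<Rightarrow> 'a set \<Rightarrow> ('a \<Rightarrow> nat) set" where
  "K_shift G K = {restrict (indicator V) (carrier G) | V. maximal_separated G K V}"

end

theory Submission
  imports Defs
begin

text \<open>
  Join two distinct elements \<open>g\<close> and \<open>h\<close> of the group by an edge when \<open>K g\<close> and \<open>K h\<close> meet. The separated
  sets are the independent sets of this graph, and the maximal separated sets are its maximal
  independent sets: independent sets that also dominate every vertex (\<open>maximal_separated_iff\<close>).
  Three features of the graph carry the proof.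

  \<^item> Every independent set extends to a maximal one, by Zorn's lemma (\<open>separated_extends\<close>).
  \<^item> Right translations are automorphisms of the graph, so the \<open>K\<close>-shift is invariant.
  \<^item> As \<open>K\<close> is finite, each vertex has finitely many neighbours (\<open>finite_meeting\<close>), so being
    independent and dominating is a conjunction of conditions each of which looks at finitely many
    coordinates. This makes the \<open>K\<close>-shift closed.

  For the specification property, put \<open>M = K K\<inverse>K\<close> and let two patterns be cut out of maximal
  separated sets \<open>V\<^sub>1\<close>, \<open>V\<^sub>2\<close> over \<open>A\<^sub>1\<close>, \<open>A\<^sub>2\<close>. The pattern over \<open>A\<^sub>i\<close> is forced already by the set \<open>F\<^sub>i\<close>
  of those elements of \<open>V\<^sub>i\<close> that are equal or adjacent to an element of \<open>A\<^sub>i\<close>: a point of \<open>A\<^sub>i\<close> inside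
  \<open>V\<^sub>i\<close> is in \<open>F\<^sub>i\<close>, and one outside \<open>V\<^sub>i\<close> has a neighbour in \<open>F\<^sub>i\<close>, hence lies in no independent set
  containing \<open>F\<^sub>i\<close> (\<open>near_part_forces_pattern\<close>). Now \<open>F\<^sub>i \<subseteq> K\<inverse>K A\<^sub>i\<close>, so \<open>K F\<^sub>i \<subseteq> M A\<^sub>i\<close>
  (\<open>near_part_in_margin\<close>), and when \<open>A\<^sub>1\<close> and \<open>A\<^sub>2\<close> are \<open>M\<close>-apart no element of \<open>F\<^sub>1\<close> is equal or
  adjacent to one of \<open>F\<^sub>2\<close>. So \<open>F\<^sub>1 \<union> F\<^sub>2\<close> is independent, and any maximal independent set extending
  it realises both patterns.
\<close>

section \<open>Maximal separated sets as maximal independent sets\<close>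

lemma separated_iff:
  fixes G (structure)
  shows "separated G K V \<longleftrightarrow>
    V \<subseteq> carrier G \<and> (\<forall>g\<in>V. \<forall>h\<in>V. (K #> g) \<inter> (K #> h) \<noteq> {} \<longrightarrow> g = h)"
  unfolding separated_def disjoint_family_on_def by blast

text \<open>
  Domination includes the vertex itself: since \<open>K\<close> is nonempty, \<open>K g\<close> meets itself, so elements of
  \<open>V\<close> need no separate case.
\<close>

lemma maximal_separated_iff:
  fixes G (structure)
  assumes "K \<noteq> {}"
  shows "maximal_separated G K V \<longleftrightarrow>
    separated G K V \<and> (\<forall>g\<in>carrier G. \<exists>v\<in>V. (K #> g) \<inter> (K #> v) \<noteq> {})"
proof -
  have self: "(K #> g) \<inter> (K #> g) \<noteq> {}" for g
    using assms by (auto simp: r_coset_def)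
  show ?thesis
  proof (cases "separated G K V")
    case True
    have "separated G K (V \<union> {g}) \<longleftrightarrow> (\<forall>v\<in>V. (K #> g) \<inter> (K #> v) = {})"
      if "g \<in> carrier G - V" for g
      using True that unfolding separated_iff by (auto simp: Int_commute)
    moreover have "\<exists>v\<in>V. (K #> g) \<inter> (K #> v) \<noteq> {}" if "g \<in> V" for g
      using that self by blast
    ultimately show ?thesis
      using True unfolding maximal_separated_def by blast
  qed (simp add: maximal_separated_def)
qed

lemma separated_extends:
  fixes G (structure)
  assumes "separated G K F"
  obtains V where "maximal_separated G K V" and "F \<subseteq> V"
proof -
  let ?E = "{V. separated G K V \<and> F \<subseteq> V}"
  have "\<exists>V\<in>?E. \<forall>W\<in>?E. V \<subseteq> W \<longrightarrow> W = V"
  proof (rule subset_Zorn_nonempty)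
    show "?E \<noteq> {}" using assms by blast
    fix \<C> assume "\<C> \<noteq> {}" and chain: "subset.chain ?E \<C>"
    have "g = h" if "X \<in> \<C>" "g \<in> X" "Y \<in> \<C>" "h \<in> Y" "(K #> g) \<inter> (K #> h) \<noteq> {}" for X Y g h
    proof -
      have "X \<subseteq> Y \<or> Y \<subseteq> X" "separated G K X" "separated G K Y"
        using chain that unfolding subset_chain_def by blast+
      then show ?thesis
        using that unfolding separated_iff by blast
    qed
    moreover have "X \<subseteq> carrier G" "F \<subseteq> X" if "X \<in> \<C>" for X
      using chain that unfolding subset_chain_def separated_iff by blast+
    ultimately have "separated G K (\<Union>\<C>)" "F \<subseteq> \<Union>\<C>"
      using \<open>\<C> \<noteq> {}\<close> unfolding separated_iff by (meson Sup_least UnionE, fast)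
    then show "\<Union>\<C> \<in> ?E"
      by simp
  qed
  then obtain V where "V \<in> ?E" and max: "\<forall>W\<in>?E. V \<subseteq> W \<longrightarrow> W = V" ..
  then have V: "separated G K V" "F \<subseteq> V"
    by simp_all
  have "\<not> separated G K (V \<union> {g})" if "g \<in> carrier G - V" for g
  proof
    assume "separated G K (V \<union> {g})"
    then have "V \<union> {g} = V"
      using V(2) max by (intro max[rule_format]) auto
    with that show False by blast
  qed
  with V have "maximal_separated G K V"
    unfolding maximal_separated_def by blast
  with V(2) that show ?thesis by blast
qed

context group
begin

lemma translates_meet:
  assumes "K \<subseteq> carrier G" "g \<in> carrier G" "g' \<in> carrier G" "h \<in> carrier G"
    and "(K #> g) \<inter> (K #> g') \<noteq> {}"
  shows "(K #> (g \<otimes> h)) \<inter> (K #> (g' \<otimes> h)) \<noteq> {}"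
proof -
  obtain x where "x \<in> K #> g" "x \<in> K #> g'"
    using assms(5) by blast
  then have "x \<otimes> h \<in> (K #> g) #> h" "x \<otimes> h \<in> (K #> g') #> h"
    by (auto simp: r_coset_def)
  then show ?thesis
    using assms by (auto simp: coset_mult_assoc)
qed

lemma mem_r_coset_iff:
  assumes "V \<subseteq> carrier G" "g \<in> carrier G" "h \<in> carrier G"
  shows "g \<in> V #> h \<longleftrightarrow> g \<otimes> inv h \<in> V"
proof
  assume "g \<in> V #> h"
  then obtain v where "v \<in> V" "g = v \<otimes> h"
    by (auto simp: r_coset_def)
  then show "g \<otimes> inv h \<in> V"
    using assms inv_solve_right' by fastforce
next
  assume "g \<otimes> inv h \<in> V"
  moreover have "g = (g \<otimes> inv h) \<otimes> h"
    using assms by (simp add: m_assoc)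
  ultimately show "g \<in> V #> h"
    unfolding r_coset_def by blast
qed

lemma maximal_separated_translate:
  assumes K: "K \<subseteq> carrier G" "K \<noteq> {}" and h: "h \<in> carrier G"
    and V: "maximal_separated G K V"
  shows "maximal_separated G K (V #> h)"
proof -
  have sub: "V \<subseteq> carrier G"
    and sep: "\<And>v w. v \<in> V \<Longrightarrow> w \<in> V \<Longrightarrow> (K #> v) \<inter> (K #> w) \<noteq> {} \<Longrightarrow> v = w"
    and dom: "\<And>g. g \<in> carrier G \<Longrightarrow> \<exists>v\<in>V. (K #> g) \<inter> (K #> v) \<noteq> {}"
    using V unfolding maximal_separated_iff[OF K(2)] separated_iff by auto
  have subh: "V #> h \<subseteq> carrier G"
    using sub h by (rule r_coset_subset_G)
  have "g = g'" if "g \<in> V #> h" "g' \<in> V #> h" "(K #> g) \<inter> (K #> g') \<noteq> {}" for g g'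
  proof -
    have gg: "g \<in> carrier G" "g' \<in> carrier G"
      using that subh by auto
    have "g \<otimes> inv h = g' \<otimes> inv h"
      using that gg mem_r_coset_iff[OF sub _ h] translates_meet[OF K(1) gg _ that(3), of "inv h"] h
      by (intro sep) auto
    then show ?thesis
      using gg h by simp
  qed
  moreover have "\<exists>v\<in>V #> h. (K #> g) \<inter> (K #> v) \<noteq> {}" if g: "g \<in> carrier G" for g
  proof -
    obtain v where v: "v \<in> V" "(K #> (g \<otimes> inv h)) \<inter> (K #> v) \<noteq> {}"
      using dom[of "g \<otimes> inv h"] g h by auto
    then have "(K #> (g \<otimes> inv h \<otimes> h)) \<inter> (K #> (v \<otimes> h)) \<noteq> {}"
      using translates_meet[OF K(1) _ _ h v(2)] sub g h by auto
    moreover have "g \<otimes> inv h \<otimes> h = g"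
      using g h by (simp add: m_assoc)
    moreover have "v \<otimes> h \<in> V #> h"
      using v unfolding r_coset_def by blast
    ultimately show ?thesis by metis
  qed
  ultimately show ?thesis
    unfolding maximal_separated_iff[OF K(2)] separated_iff using subh by blast
qed

text \<open>The graph is locally finite: the neighbours of \<open>g\<close> lie in \<open>K\<inverse>K g\<close>.\<close>

lemma finite_meeting:
  assumes "K \<subseteq> carrier G" "finite K" "g \<in> carrier G"
  shows "finite {h \<in> carrier G. (K #> g) \<inter> (K #> h) \<noteq> {}}"
proof (rule finite_subset)
  show "finite ((\<lambda>(k, l). inv l \<otimes> (k \<otimes> g)) ` (K \<times> K))"
    using assms by blast
  show "{h \<in> carrier G. (K #> g) \<inter> (K #> h) \<noteq> {}} \<subseteq> (\<lambda>(k, l). inv l \<otimes> (k \<otimes> g)) ` (K \<times> K)"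
  proof
    fix h assume "h \<in> {h \<in> carrier G. (K #> g) \<inter> (K #> h) \<noteq> {}}"
    then obtain k l where h: "h \<in> carrier G" and kl: "k \<in> K" "l \<in> K" "k \<otimes> g = l \<otimes> h"
      by (auto simp: r_coset_def)
    then have "h = inv l \<otimes> (k \<otimes> g)"
      using assms h by (metis inv_solve_left subsetD m_closed)
    with kl show "h \<in> (\<lambda>(k, l). inv l \<otimes> (k \<otimes> g)) ` (K \<times> K)" by auto
  qed
qed

section \<open>The K-shift is a subshift\<close>

lemma shift_action_indicator:
  assumes "V \<subseteq> carrier G" "h \<in> carrier G"
  shows "shift_action G h (restrict (indicator V) (carrier G)) =
    restrict (indicator (V #> inv h)) (carrier G)"
  using assms
  by (auto simp: shift_action_def mem_r_coset_iff indicator_def intro!: restrict_ext)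

lemma shift_action_K_shift:
  assumes K: "K \<subseteq> carrier G" "K \<noteq> {}" and h: "h \<in> carrier G"
  shows "shift_action G h ` K_shift G K = K_shift G K"
proof
  have sub: "V \<subseteq> carrier G" if "maximal_separated G K V" for V
    using that by (simp add: maximal_separated_def separated_def)
  show "shift_action G h ` K_shift G K \<subseteq> K_shift G K"
  proof
    fix y :: "'a \<Rightarrow> nat" assume "y \<in> shift_action G h ` K_shift G K"
    then obtain V where V: "maximal_separated G K V"
      and "y = shift_action G h (restrict (indicator V) (carrier G))"
      unfolding K_shift_def by blast
    then have "y = restrict (indicator (V #> inv h)) (carrier G)"
      using shift_action_indicator[OF sub[OF V] h, where ?'c = nat] by simp
    moreover have "maximal_separated G K (V #> inv h)"
      using maximal_separated_translate[OF K _ V] h by simp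
    ultimately show "y \<in> K_shift G K"
      unfolding K_shift_def by blast
  qed
  show "K_shift G K \<subseteq> shift_action G h ` K_shift G K"
  proof
    fix x assume "x \<in> K_shift G K"
    then obtain V where V: "maximal_separated G K V" "x = restrict (indicator V) (carrier G)"
      unfolding K_shift_def by blast
    have Vh: "maximal_separated G K (V #> h)"
      using maximal_separated_translate[OF K h V(1)] .
    have "V #> h #> inv h = V"
      using sub[OF V(1)] h by (simp add: coset_mult_assoc)
    then have "x = shift_action G h (restrict (indicator (V #> h)) (carrier G))"
      using shift_action_indicator[OF sub[OF Vh] h, where ?'c = nat] V(2) by simp
    with Vh show "x \<in> shift_action G h ` K_shift G K"
      unfolding K_shift_def by blast
  qed
qed

end

text \<open>
  The values of \<open>x\<close> on a finite window \<open>F\<close> cut out a cylinder, an open neighbourhood of \<open>x\<close>; the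
  assumption makes this neighbourhood disjoint from \<open>X\<close>.
\<close>

lemma closedin_product_discreteI:
  assumes "X \<subseteq> I \<rightarrow>\<^sub>E \<Lambda>"
    and window: "\<And>x. x \<in> (I \<rightarrow>\<^sub>E \<Lambda>) - X \<Longrightarrow>
      \<exists>F. finite F \<and> F \<subseteq> I \<and> (\<forall>y\<in>I \<rightarrow>\<^sub>E \<Lambda>. (\<forall>i\<in>F. y i = x i) \<longrightarrow> y \<notin> X)"
  shows "closedin (product_topology (\<lambda>_. discrete_topology \<Lambda>) I) X"
proof -
  let ?T = "product_topology (\<lambda>_. discrete_topology \<Lambda>) I"
  have "\<exists>U. finite {i \<in> I. U i \<noteq> \<Lambda>} \<and> (\<forall>i\<in>I. U i \<subseteq> \<Lambda>) \<and> x \<in> Pi\<^sub>E I U \<and>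
      Pi\<^sub>E I U \<subseteq> (I \<rightarrow>\<^sub>E \<Lambda>) - X" if x: "x \<in> (I \<rightarrow>\<^sub>E \<Lambda>) - X" for x
  proof -
    obtain F where F: "finite F" "F \<subseteq> I" "\<forall>y\<in>I \<rightarrow>\<^sub>E \<Lambda>. (\<forall>i\<in>F. y i = x i) \<longrightarrow> y \<notin> X"
      using window[OF x] by blast
    define U where "U = (\<lambda>i. if i \<in> F then {x i} else \<Lambda>)"
    have sub: "\<forall>i\<in>I. U i \<subseteq> \<Lambda>"
      using x by (auto simp: U_def)
    have "finite {i \<in> I. U i \<noteq> \<Lambda>}"
      by (rule finite_subset[OF _ F(1)]) (auto simp: U_def)
    moreover have "x \<in> Pi\<^sub>E I U"
      using x by (auto simp: U_def PiE_iff)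
    moreover have "Pi\<^sub>E I U \<subseteq> (I \<rightarrow>\<^sub>E \<Lambda>) - X"
    proof
      fix y assume y: "y \<in> Pi\<^sub>E I U"
      have "y i = x i" if "i \<in> F" for i
        using y F(2) that PiE_mem[of y I U i] by (auto simp: U_def)
      moreover have "y \<in> I \<rightarrow>\<^sub>E \<Lambda>"
        using y sub by (auto simp: PiE_iff)
      ultimately show "y \<in> (I \<rightarrow>\<^sub>E \<Lambda>) - X"
        using F(3) by blast
    qed
    ultimately show ?thesis
      using sub by blast
  qed
  then have "openin ?T ((I \<rightarrow>\<^sub>E \<Lambda>) - X)"
    unfolding openin_product_topology_alt by simp
  then show ?thesis
    using assms(1) by (simp add: closedin_def)
qed

context group
begin

lemma closedin_K_shift:
  assumes K: "K \<subseteq> carrier G" "K \<noteq> {}" "finite K"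
  shows "closedin (product_topology (\<lambda>_. discrete_topology {0, 1}) (carrier G)) (K_shift G K)"
proof (rule closedin_product_discreteI)
  show "K_shift G K \<subseteq> carrier G \<rightarrow>\<^sub>E {0, 1}"
    by (auto simp: K_shift_def indicator_def)
  fix x :: "'a \<Rightarrow> nat" assume x: "x \<in> (carrier G \<rightarrow>\<^sub>E {0, 1}) - K_shift G K"
  define V where "V = {g \<in> carrier G. x g = 1}"
  have "x = restrict (indicator V) (carrier G)"
    using x by (intro extensionalityI[of _ "carrier G"])
      (auto simp: V_def indicator_def PiE_iff)
  then have "\<not> maximal_separated G K V"
    using x unfolding K_shift_def by blast
  moreover have "V \<subseteq> carrier G"
    by (auto simp: V_def)
  ultimately consider
      (sep) g h where "g \<in> V" "h \<in> V" "(K #> g) \<inter> (K #> h) \<noteq> {}" "g \<noteq> h"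
    | (dom) g where "g \<in> carrier G" "\<forall>v\<in>V. (K #> g) \<inter> (K #> v) = {}"
    unfolding maximal_separated_iff[OF K(2)] separated_iff by metis
  \<comment> \<open>An edge inside \<open>V\<close> is visible on its two ends; an undominated vertex is visible on its
    neighbourhood, where \<open>x\<close> vanishes.\<close>
  then show "\<exists>F. finite F \<and> F \<subseteq> carrier G \<and>
      (\<forall>y\<in>carrier G \<rightarrow>\<^sub>E {0, 1}. (\<forall>i\<in>F. y i = x i) \<longrightarrow> y \<notin> K_shift G K)"
  proof cases
    case sep
    have "y \<notin> K_shift G K" if y: "\<forall>i\<in>{g, h}. y i = x i" for y
    proof
      assume "y \<in> K_shift G K"
      then obtain W where W: "maximal_separated G K W" "y = restrict (indicator W) (carrier G)"
        unfolding K_shift_def by blast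
      then have "g \<in> W" "h \<in> W"
        using y sep(1,2) by (auto simp: V_def indicator_eq_1_iff simp del: One_nat_def)
      then show False
        using W(1) sep(3,4) unfolding maximal_separated_iff[OF K(2)] separated_iff by blast
    qed
    with sep(1,2) show ?thesis
      by (intro exI[of _ "{g, h}"]) (auto simp: V_def)
  next
    case dom
    let ?F = "{h \<in> carrier G. (K #> g) \<inter> (K #> h) \<noteq> {}}"
    have "y \<notin> K_shift G K" if y: "\<forall>i\<in>?F. y i = x i" for y
    proof
      assume "y \<in> K_shift G K"
      then obtain W where W: "maximal_separated G K W" "y = restrict (indicator W) (carrier G)"
        unfolding K_shift_def by blast
      obtain w where w: "w \<in> W" "(K #> g) \<inter> (K #> w) \<noteq> {}"
        using W(1) dom(1) unfolding maximal_separated_iff[OF K(2)] by blast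
      have "w \<in> carrier G"
        using w(1) W(1) by (auto simp: maximal_separated_def separated_def)
      with w y W(2) have "x w = 1" by force
      with \<open>w \<in> carrier G\<close> w(2) dom(2) show False
        by (auto simp: V_def)
    qed
    then show ?thesis
      using finite_meeting[OF K(1,3) dom(1)] by (intro exI[of _ ?F]) auto
  qed
qed

section \<open>Patterns and nontriviality\<close>

text \<open>
  The group element in the definition of admissibility is absorbed by translating the maximal
  separated set.
\<close>

lemma admissible_K_shift_iff:
  assumes K: "K \<subseteq> carrier G" "K \<noteq> {}" and A: "A \<subseteq> carrier G"
  shows "admissible G (K_shift G K) A \<alpha> \<longleftrightarrow>
    (\<exists>V. maximal_separated G K V \<and> (\<forall>a\<in>A. \<alpha> a = indicator V a))"
proof
  assume "admissible G (K_shift G K) A \<alpha>"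
  then obtain V g where V: "maximal_separated G K V" and g: "g \<in> carrier G"
    and \<alpha>: "\<forall>a\<in>A. restrict (indicator V) (carrier G) (a \<otimes> g) = \<alpha> a"
    unfolding admissible_def K_shift_def by blast
  have "V \<subseteq> carrier G"
    using V by (simp add: maximal_separated_def separated_def)
  then have "a \<in> V #> inv g \<longleftrightarrow> a \<otimes> g \<in> V" if "a \<in> A" for a
    using mem_r_coset_iff[of V a "inv g"] g A that by auto
  then have "\<forall>a\<in>A. \<alpha> a = indicator (V #> inv g) a"
    using \<alpha> A g by (auto simp: indicator_def subset_iff)
  moreover have "maximal_separated G K (V #> inv g)"
    using maximal_separated_translate[OF K _ V] g by blast
  ultimately show "\<exists>V. maximal_separated G K V \<and> (\<forall>a\<in>A. \<alpha> a = indicator V a)"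
    by blast
next
  assume "\<exists>V. maximal_separated G K V \<and> (\<forall>a\<in>A. \<alpha> a = indicator V a)"
  then obtain V where V: "maximal_separated G K V" "\<forall>a\<in>A. \<alpha> a = indicator V a"
    by blast
  then have "\<forall>a\<in>A. restrict (indicator V) (carrier G) (a \<otimes> \<one>) = \<alpha> a"
    using A by auto
  with V(1) show "admissible G (K_shift G K) A \<alpha>"
    unfolding admissible_def K_shift_def by blast
qed

text \<open>
  A maximal separated set containing \<open>\<one>\<close> exists and shows the symbol \<open>1\<close>. It misses every
  \<open>k \<in> K - {\<one>}\<close>, since \<open>k\<close> lies in both \<open>K \<one>\<close> and \<open>K k\<close>; this shows the symbol \<open>0\<close>.
\<close>

lemma nontrivial_K_shift:
  assumes K: "K \<subseteq> carrier G" "finite K" "\<one> \<in> K" and k: "k \<in> K" "k \<noteq> \<one>"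
  shows "nontrivial_subshift G {0, 1} (K_shift G K)"
proof -
  have ne: "K \<noteq> {}" using K by blast
  have kG: "k \<in> carrier G" using k K by blast
  have "subshift G {0, 1} (K_shift G K)"
    unfolding subshift_def
    using closedin_K_shift[OF K(1) ne K(2)] shift_action_K_shift[OF K(1) ne] by simp
  moreover
  have "separated G K {\<one>}"
    by (simp add: separated_iff)
  then obtain V where V: "maximal_separated G K V" "\<one> \<in> V"
    using separated_extends by blast
  have "k \<in> (K #> \<one>) \<inter> (K #> k)"
    using K k kG by (force simp: r_coset_def)
  then have "k \<notin> V"
    using V k(2) unfolding maximal_separated_iff[OF ne] separated_iff by blast
  then have "restrict (indicator V) (carrier G) (\<one> \<otimes> k) = (0::nat)"
    "restrict (indicator V) (carrier G) (\<one> \<otimes> \<one>) = (1::nat)"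
    using V(2) kG by auto
  then have "0 \<in> admissible_symbols G {0, 1} (K_shift G K)"
    "1 \<in> admissible_symbols G {0, 1} (K_shift G K)"
    using V(1) kG unfolding admissible_symbols_def admissible_def K_shift_def by fastforce+
  ultimately show ?thesis
    unfolding nontrivial_subshift_def by (metis zero_neq_one)
qed

section \<open>Gluing patterns\<close>

text \<open>For subsets \<open>V\<close>, \<open>A\<close> of the group, \<open>near_part K V A\<close> is \<open>V \<inter> K\<inverse>K A\<close>.\<close>

definition near_part :: "'a set \<Rightarrow> 'a set \<Rightarrow> 'a set \<Rightarrow> 'a set" where
  "near_part K V A = {v \<in> V. \<exists>a\<in>A. (K #> a) \<inter> (K #> v) \<noteq> {}}"

text \<open>If \<open>K v\<close> meets \<open>K a\<close>, then \<open>v \<in> K\<inverse>K a\<close>; one more factor \<open>K\<close> on the left gives the margin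
  \<open>K K\<inverse>K\<close>.\<close>

lemma near_part_in_margin:
  assumes K: "K \<subseteq> carrier G" and "V \<subseteq> carrier G" and "A \<subseteq> carrier G"
    and v: "v \<in> near_part K V A"
  shows "K #> v \<subseteq> (K <#> set_inv K <#> K) <#> A"
proof
  fix x assume "x \<in> K #> v"
  then obtain k where k: "k \<in> K" "x = k \<otimes> v"
    by (auto simp: r_coset_def)
  obtain a where a: "a \<in> A" and "(K #> a) \<inter> (K #> v) \<noteq> {}"
    using v unfolding near_part_def by blast
  then obtain l m where lm: "l \<in> K" "m \<in> K" "m \<otimes> a = l \<otimes> v"
    by (auto simp: r_coset_def)
  have c: "v \<in> carrier G" "a \<in> carrier G" "k \<in> carrier G" "l \<in> carrier G" "m \<in> carrier G"
    using assms v k a lm by (auto simp: near_part_def)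
  have "v = inv l \<otimes> (m \<otimes> a)"
    using lm(3) c by (metis inv_solve_left m_closed)
  then have "x = k \<otimes> inv l \<otimes> m \<otimes> a"
    using k c by (simp add: m_assoc)
  moreover have "k \<otimes> inv l \<otimes> m \<in> K <#> set_inv K <#> K"
    using k lm unfolding set_mult_def SET_INV_def by blast
  ultimately show "x \<in> (K <#> set_inv K <#> K) <#> A"
    using a unfolding set_mult_def by blast
qed

text \<open>
  A point of \<open>A\<close> outside \<open>V\<close> is kept out of \<open>W\<close> by a neighbour in
  \<open>near_part K V A\<close>, which exists because \<open>V\<close> is maximal.
\<close>

lemma near_part_forces_pattern:
  assumes "K \<noteq> {}" and V: "maximal_separated G K V" and W: "separated G K W"
    and "near_part K V A \<subseteq> W" and a: "a \<in> A" "a \<in> carrier G"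
  shows "a \<in> W \<longleftrightarrow> a \<in> V"
proof -
  obtain v where v: "v \<in> V" "(K #> a) \<inter> (K #> v) \<noteq> {}"
    using V a unfolding maximal_separated_iff[OF assms(1)] by blast
  then have "v \<in> W"
    using assms(4) a by (auto simp: near_part_def)
  \<comment> \<open>Both sets are separated and contain \<open>v\<close>, so \<open>a\<close> belongs to either of them only if \<open>a = v\<close>.\<close>
  then have "a \<in> W \<longleftrightarrow> a = v"
    using W v unfolding separated_iff by blast
  moreover have "a \<in> V \<longleftrightarrow> a = v"
    using V v unfolding maximal_separated_def separated_iff by blast
  ultimately show ?thesis by simp
qed

lemma separated_near_parts:
  assumes K: "K \<subseteq> carrier G" and A: "A\<^sub>1 \<subseteq> carrier G" "A\<^sub>2 \<subseteq> carrier G"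
    and apart: "apart G (K <#> set_inv K <#> K) A\<^sub>1 A\<^sub>2"
    and V: "separated G K V\<^sub>1" "separated G K V\<^sub>2"
  shows "separated G K (near_part K V\<^sub>1 A\<^sub>1 \<union> near_part K V\<^sub>2 A\<^sub>2)"
proof -
  have sub: "V\<^sub>1 \<subseteq> carrier G" "V\<^sub>2 \<subseteq> carrier G"
    using V by (simp_all add: separated_def)
  have near: "near_part K V\<^sub>1 A\<^sub>1 \<subseteq> V\<^sub>1" "near_part K V\<^sub>2 A\<^sub>2 \<subseteq> V\<^sub>2"
    by (auto simp: near_part_def)
  have disj: "(K #> v) \<inter> (K #> w) = {}" "(K #> w) \<inter> (K #> v) = {}"
    if "v \<in> near_part K V\<^sub>1 A\<^sub>1" "w \<in> near_part K V\<^sub>2 A\<^sub>2" for v w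
    using near_part_in_margin[OF K sub(1) A(1) that(1)] near_part_in_margin[OF K sub(2) A(2) that(2)]
      apart unfolding apart_def by blast+
  have sep: "g = h" if "g \<in> V\<^sub>1 \<and> h \<in> V\<^sub>1 \<or> g \<in> V\<^sub>2 \<and> h \<in> V\<^sub>2" "(K #> g) \<inter> (K #> h) \<noteq> {}" for g h
    using V that unfolding separated_iff by presburger
  show ?thesis
    unfolding separated_iff
  proof (intro conjI ballI impI)
    show "near_part K V\<^sub>1 A\<^sub>1 \<union> near_part K V\<^sub>2 A\<^sub>2 \<subseteq> carrier G"
      using near sub by blast
    fix g h assume "g \<in> near_part K V\<^sub>1 A\<^sub>1 \<union> near_part K V\<^sub>2 A\<^sub>2"
      "h \<in> near_part K V\<^sub>1 A\<^sub>1 \<union> near_part K V\<^sub>2 A\<^sub>2" and meet: "(K #> g) \<inter> (K #> h) \<noteq> {}"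
    then consider "g \<in> near_part K V\<^sub>1 A\<^sub>1" "h \<in> near_part K V\<^sub>1 A\<^sub>1"
      | "g \<in> near_part K V\<^sub>2 A\<^sub>2" "h \<in> near_part K V\<^sub>2 A\<^sub>2"
      | "g \<in> near_part K V\<^sub>1 A\<^sub>1" "h \<in> near_part K V\<^sub>2 A\<^sub>2"
      | "g \<in> near_part K V\<^sub>2 A\<^sub>2" "h \<in> near_part K V\<^sub>1 A\<^sub>1"
      by (elim UnE)
    then show "g = h"
    proof cases
      case 1
      with near(1) have "g \<in> V\<^sub>1" "h \<in> V\<^sub>1" by (simp_all add: subsetD)
      then show ?thesis using sep meet by simp
    next
      case 2
      with near(2) have "g \<in> V\<^sub>2" "h \<in> V\<^sub>2" by (simp_all add: subsetD)
      then show ?thesis using sep meet by simp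
    next
      case 3
      with disj(1) meet show ?thesis by simp
    next
      case 4
      with disj(2) meet show ?thesis by simp
    qed
  qed
qed

lemma K_shift_glue:
  assumes K: "K \<subseteq> carrier G" "K \<noteq> {}" and A: "A\<^sub>1 \<subseteq> carrier G" "A\<^sub>2 \<subseteq> carrier G"
    and apart: "apart G (K <#> set_inv K <#> K) A\<^sub>1 A\<^sub>2"
    and adm: "admissible G (K_shift G K) A\<^sub>1 \<alpha>\<^sub>1" "admissible G (K_shift G K) A\<^sub>2 \<alpha>\<^sub>2"
  shows "admissible G (K_shift G K) (A\<^sub>1 \<union> A\<^sub>2) (\<lambda>a\<in>A\<^sub>1 \<union> A\<^sub>2. if a \<in> A\<^sub>1 then \<alpha>\<^sub>1 a else \<alpha>\<^sub>2 a)"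
proof -
  obtain V\<^sub>1 where V1: "maximal_separated G K V\<^sub>1" "\<forall>a\<in>A\<^sub>1. \<alpha>\<^sub>1 a = indicator V\<^sub>1 a"
    using adm(1) admissible_K_shift_iff[OF K A(1)] by blast
  obtain V\<^sub>2 where V2: "maximal_separated G K V\<^sub>2" "\<forall>a\<in>A\<^sub>2. \<alpha>\<^sub>2 a = indicator V\<^sub>2 a"
    using adm(2) admissible_K_shift_iff[OF K A(2)] by blast
  have "separated G K (near_part K V\<^sub>1 A\<^sub>1 \<union> near_part K V\<^sub>2 A\<^sub>2)"
    using separated_near_parts[OF K(1) A apart] V1(1) V2(1) by (simp add: maximal_separated_def)
  then obtain W where W: "maximal_separated G K W"
    and sub: "near_part K V\<^sub>1 A\<^sub>1 \<subseteq> W" "near_part K V\<^sub>2 A\<^sub>2 \<subseteq> W"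
    using separated_extends by (metis Un_subset_iff)
  have sep: "separated G K W"
    using W by (simp add: maximal_separated_def)
  have "\<forall>a\<in>A\<^sub>1. a \<in> W \<longleftrightarrow> a \<in> V\<^sub>1" "\<forall>a\<in>A\<^sub>2. a \<in> W \<longleftrightarrow> a \<in> V\<^sub>2"
    using near_part_forces_pattern[OF K(2) V1(1) sep sub(1)]
      near_part_forces_pattern[OF K(2) V2(1) sep sub(2)] A by blast+
  then have "\<forall>a\<in>A\<^sub>1 \<union> A\<^sub>2. (\<lambda>a\<in>A\<^sub>1 \<union> A\<^sub>2. if a \<in> A\<^sub>1 then \<alpha>\<^sub>1 a else \<alpha>\<^sub>2 a) a = indicator W a"
    using V1(2) V2(2) by (auto simp: indicator_def)
  with W show ?thesis
    using admissible_K_shift_iff[OF K, of "A\<^sub>1 \<union> A\<^sub>2"] A by blast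
qed

end

theorem lemma1p18:
  fixes G (structure) and K :: "'a set"
  assumes "group G"
    and "infinite (carrier G)" and "countable (carrier G)"
    and "K \<subseteq> carrier G" and "finite K"
    and "\<one> \<in> K" and "\<exists>k\<in>K. k \<noteq> \<one>"
  shows "specification_property G {0, 1} (K_shift G K) (K <#> set_inv K <#> K)"
proof -
  interpret group G by fact
  let ?M = "K <#> set_inv K <#> K"
  have ne: "K \<noteq> {}" using assms by blast
  have "finite (set_inv K)" "set_inv K \<subseteq> carrier G"
    using assms by (auto simp: SET_INV_def)
  then have "finite ?M" "?M \<subseteq> carrier G"
    using assms by (auto simp: set_mult_def)
  moreover have "\<one> \<in> ?M"
  proof -
    have "\<one> \<otimes> inv \<one> \<otimes> \<one> \<in> ?M"
      using assms(6) unfolding set_mult_def SET_INV_def by blast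
    then show ?thesis by simp
  qed
  moreover have "nontrivial_subshift G {0, 1} (K_shift G K)"
    using nontrivial_K_shift assms by blast
  ultimately show ?thesis
    unfolding specification_property_def using K_shift_glue[OF assms(4) ne] by blast
qed

end
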